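(* Assume A1 and A2 (stated in the context). Let $\delta>0$ and $y^\delta\in Y$ with $\|y^\delta-y\|\le\delta$. If $x\in B_\rho(x_0)$, then $$0\ \ge\ \|F_\delta(x)\|\big[(1-\eta)\|F_\delta(x)\|-(1+\eta)\delta\big]+\langle x^\star-x,\,F'(x)^*F_\delta(x)\rangle\qquad\text{for all }x^\star\in B_\rho(x_0)\cap F^{-1}(y).$$ Consequently, $B_\rho(x_0)\cap F^{-1}(y)\subset H_x^\delta$, where $$H_x^\delta:=\Big\{z\in X:\ \langle z-x,\,F'(x)^*F_\delta(x)\rangle\le-\|F_\delta(x)\|\big((1-\eta)\|F_\delta(x)\|-(1+\eta)\delta\big)\Big\}.$$
   Context: $X,Y$ are real Hilbert spaces, $F:D(F)\subset X\to Y$ is a (nonlinear) operator, $y\in Y$ is the exact data, $F_\delta(x):=F(x)-y^\delta$, and $F^{-1}(y)=\{x\in D(F):F(x)=y\}$. $B_r(z)$ denotes the open ball of radius $r$ centered at $z$ in $X$. A1: $F$ is continuous on $D(F)$, which has nonempty interior; there are constants $C,\rho>0$ and $x_0\in D(F)$ with $B_\rho(x_0)\subset D(F)$ such that the Gateaux derivative $F'(x)$ (a bounded linear operator $X\to Y$) exists for $x\in B_\rho(x_0)$ and $\|F'(x)\|\le C$ there. A2 (tangential cone condition): there is a constant $\eta\in[0,1)$ such that $\|F(\bar x)-F(x)-F'(x)(\bar x-x)\|\le\eta\|F(\bar x)-F(x)\|$ for all $x,\bar x\in B_\rho(x_0)$. *)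

theory Defs
  imports "HOL-Analysis.Analysis"
begin

text \<open>
  An operator with domain \<open>D \<subseteq> X\<close> is a total function \<open>F\<close> together with the set \<open>D\<close>; a Hilbert
  space is a type of sort \<open>{real_inner, complete_space}\<close>.

  In the next definition the values of \<open>F\<close> outside its domain play no role whenever \<open>x\<close> is an
  interior point of the domain, because then \<open>x + t *\<^sub>R h\<close> lies in the domain for all small \<open>t\<close>.
\<close>

definition has_gateaux_derivative ::
  "('a::real_normed_vector \<Rightarrow> 'b::real_normed_vector) \<Rightarrow> ('a \<Rightarrow>\<^sub>L 'b) \<Rightarrow> 'a \<Rightarrow> bool"
  where "has_gateaux_derivative F A x \<longleftrightarrow>
    (\<forall>h. ((\<lambda>t::real. (F (x + t *\<^sub>R h) - F x) /\<^sub>R t) \<longlongrightarrow> blinfun_apply A h) (at 0))"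

definition assumption_A1 ::
  "'a set \<Rightarrow> ('a::{real_inner,complete_space} \<Rightarrow> 'b::{real_inner,complete_space}) \<Rightarrow>
    ('a \<Rightarrow> 'a \<Rightarrow>\<^sub>L 'b) \<Rightarrow> real \<Rightarrow> real \<Rightarrow> 'a \<Rightarrow> bool"
  where "assumption_A1 D F F' C \<rho> x\<^sub>0 \<longleftrightarrow>
    continuous_on D F \<and> interior D \<noteq> {} \<and> C > 0 \<and> \<rho> > 0 \<and> x\<^sub>0 \<in> D \<and> ball x\<^sub>0 \<rho> \<subseteq> D \<and>
    (\<forall>x\<in>ball x\<^sub>0 \<rho>. has_gateaux_derivative F (F' x) x \<and> norm (F' x) \<le> C)"

definition tangential_cone_condition ::
  "('a::{real_inner,complete_space} \<Rightarrow> 'b::{real_inner,complete_space}) \<Rightarrow>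
    ('a \<Rightarrow> 'a \<Rightarrow>\<^sub>L 'b) \<Rightarrow> real \<Rightarrow> real \<Rightarrow> 'a \<Rightarrow> bool"
  where "tangential_cone_condition F F' \<eta> \<rho> x\<^sub>0 \<longleftrightarrow>
    0 \<le> \<eta> \<and> \<eta> < 1 \<and>
    (\<forall>x\<in>ball x\<^sub>0 \<rho>. \<forall>x'\<in>ball x\<^sub>0 \<rho>.
      norm (F x' - F x - blinfun_apply (F' x) (x' - x)) \<le> \<eta> * norm (F x' - F x))"

definition preimage_in :: "'a set \<Rightarrow> ('a \<Rightarrow> 'b) \<Rightarrow> 'b \<Rightarrow> 'a set"
  where "preimage_in D F y = {x \<in> D. F x = y}"

definition residual :: "('a \<Rightarrow> 'b::real_normed_vector) \<Rightarrow> 'b \<Rightarrow> 'a \<Rightarrow> 'b"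
  where "residual F y\<^sub>\<delta> x = F x - y\<^sub>\<delta>"

text \<open>
  The library function \<^const>\<open>adjoint\<close> is a choice of some \<open>g\<close> with \<open>A u \<bullet> v = u \<bullet> g v\<close> for all
  \<open>u\<close>, \<open>v\<close>. For bounded \<open>A\<close> on a Hilbert space such a \<open>g\<close> exists (Riesz) and is unique, so this
  is the Hilbert space adjoint.
\<close>

definition half_space_H ::
  "('a::{real_inner,complete_space} \<Rightarrow> 'b::{real_inner,complete_space}) \<Rightarrow>
    ('a \<Rightarrow> 'a \<Rightarrow>\<^sub>L 'b) \<Rightarrow> real \<Rightarrow> real \<Rightarrow> 'b \<Rightarrow> 'a \<Rightarrow> 'a set"
  where "half_space_H F F' \<eta> \<delta> y\<^sub>\<delta> x =
    {z. (z - x) \<bullet> adjoint (blinfun_apply (F' x)) (residual F y\<^sub>\<delta> x)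
          \<le> - (norm (residual F y\<^sub>\<delta> x) *
                ((1 - \<eta>) * norm (residual F y\<^sub>\<delta> x) - (1 + \<eta>) * \<delta>))}"

end

theory Submission
  imports Defs
begin

text \<open>
  Writing \<open>r = F x - y\<^sub>\<delta>\<close> and \<open>h = x' - x\<close>, one has
  \<open>F' x h = (y - y\<^sub>\<delta>) - r - (F x' - F x - F' x h)\<close>. Taking the inner product with \<open>r\<close>, the noise
  bound controls the first term and the tangential cone condition the last one, since
  \<open>\<parallel>F x' - F x\<parallel> \<le> \<parallel>r\<parallel> + \<delta>\<close>. The adjoint is obtained from the Riesz representation theorem, whose
  representer is the minimiser of \<open>\<parallel>u\<parallel>\<^sup>2 - 2 f u\<close>.
\<close>

theorem riesz_representation:
  fixes f :: "'a::{real_inner,complete_space} \<Rightarrow> real"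
  assumes "bounded_linear f"
  shows "\<exists>g. \<forall>u. f u = u \<bullet> g"
proof -
  interpret f: bounded_linear f by fact
  \<comment> \<open>If \<open>g\<close> represents \<open>f\<close>, then \<open>J u\<close> is
    \<open>(norm (u - g))\<^sup>2 - (norm g)\<^sup>2\<close>, so \<open>g\<close> has to be the
    minimiser of \<open>J\<close>.\<close>
  define J where "J u = (norm u)\<^sup>2 - 2 * f u" for u
  define m where "m = (INF u. J u)"
  obtain K where K: "\<And>u. norm (f u) \<le> norm u * K"
    using f.bounded by blast
  \<comment> \<open>Completing the square: \<open>J u\<close> is at least
    \<open>(norm u - K)\<^sup>2 - K\<^sup>2\<close>.\<close>
  have "- K\<^sup>2 \<le> J u" for u
  proof -
    have "f u \<le> norm u * K"
      using K[of u] by simp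
    then show ?thesis
      using zero_le_power2[of "norm u - K"] by (simp add: J_def power2_diff)
  qed
  then have "bdd_below (range J)"
    by (rule bdd_belowI2)
  then have m_le: "m \<le> J u" for u
    unfolding m_def by (simp add: cINF_lower)
  have "\<exists>u. J u < m + inverse (real (Suc n))" for n
    using cInf_lessD[of "range J" "m + inverse (real (Suc n))"] by (auto simp: m_def)
  then obtain s where s: "\<And>n. J (s n) < m + inverse (real (Suc n))"
    by metis
  have J_s: "(\<lambda>n. J (s n)) \<longlonglongrightarrow> m"
  proof (rule tendsto_sandwich[where f = "\<lambda>_. m"])
    show "(\<lambda>n. m + inverse (real (Suc n))) \<longlonglongrightarrow> m"
      using tendsto_add[OF tendsto_const LIMSEQ_inverse_real_of_nat, of m] by simp
    show "\<forall>\<^sub>F n in sequentially. J (s n) \<le> m + inverse (real (Suc n))"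
      using s by (intro always_eventually allI less_imp_le)
  qed (simp_all add: m_le)
  \<comment> \<open>Parallelogram law: \<open>J\<close> is uniformly convex, so minimising sequences are Cauchy.\<close>
  have dist_le: "(norm (u - v))\<^sup>2 \<le> 2 * ((J u - m) + (J v - m))" for u v
  proof -
    define w where "w = (1/2) *\<^sub>R (u + v)"
    have "J u + J v - 2 * J w = (norm (u - v))\<^sup>2 / 2"
      by (simp add: J_def w_def f.add f.scaleR power2_norm_eq_inner inner_add inner_diff
          inner_commute field_simps)
    then show ?thesis
      using m_le[of w] by (simp add: field_simps)
  qed
  have "Cauchy s"
  proof (rule CauchyI)
    fix e :: real
    assume "0 < e"
    \<comment> \<open>The factor 1/4 makes the bound in \<open>dist_le\<close> add up to
      \<open>e\<^sup>2\<close>.\<close>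
    then have "\<forall>\<^sub>F n in sequentially. J (s n) < m + e\<^sup>2 / 4"
      by (intro order_tendstoD(2)[OF J_s]) simp
    then obtain M where M: "\<And>n. n \<ge> M \<Longrightarrow> J (s n) < m + e\<^sup>2 / 4"
      by (auto simp: eventually_sequentially)
    have "norm (s p - s q) < e" if "p \<ge> M" "q \<ge> M" for p q
    proof (rule power2_less_imp_less)
      show "(norm (s p - s q))\<^sup>2 < e\<^sup>2"
        using dist_le[of "s p" "s q"] M[OF that(1)] M[OF that(2)]
        by (simp add: field_simps)
    qed (use \<open>0 < e\<close> in simp)
    then show "\<exists>M. \<forall>p\<ge>M. \<forall>q\<ge>M. norm (s p - s q) < e"
      by blast
  qed
  then obtain g where g: "s \<longlonglongrightarrow> g"
    by (auto simp: Cauchy_convergent_iff convergent_def)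
  then have "(\<lambda>n. J (s n)) \<longlonglongrightarrow> J g"
    unfolding J_def by (intro tendsto_intros f.tendsto)
  with J_s have J_g: "J g = m"
    by (rule LIMSEQ_unique[symmetric])
  have "f h = h \<bullet> g" for h
  proof -
    define a c where "a = (norm h)\<^sup>2" and "c = h \<bullet> g - f h"
    \<comment> \<open>The quadratic \<open>t\<^sup>2 * a + 2 * t * c\<close> is the change of
      \<open>J\<close> from \<open>g\<close> to \<open>g + t *\<^sub>R h\<close>. Dividing by
      \<open>a + 1\<close> instead of \<open>a\<close> covers \<open>h = 0\<close>; at this
      \<open>t\<close> the change is \<open>- t\<^sup>2 * (a + 2)\<close>, so minimality forces
      \<open>t = 0\<close> and hence \<open>c = 0\<close>.\<close>
    define t where "t = - c / (a + 1)"
    have "a \<ge> 0"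
      by (simp add: a_def)
    have "J (g + t *\<^sub>R h) = J g + t\<^sup>2 * a + 2 * t * c"
      unfolding J_def a_def c_def power2_norm_eq_inner
      by (simp add: f.add f.scaleR inner_add inner_commute power2_eq_square algebra_simps)
    then have "0 \<le> t\<^sup>2 * a + 2 * t * c"
      using m_le[of "g + t *\<^sub>R h"] J_g by simp
    moreover have "c = - t * (a + 1)"
      using \<open>a \<ge> 0\<close> by (simp add: t_def)
    ultimately have "t\<^sup>2 * (a + 2) \<le> 0"
      by (simp add: power2_eq_square algebra_simps)
    then have "t = 0"
      using \<open>a \<ge> 0\<close> by (simp add: mult_le_0_iff)
    with \<open>c = - t * (a + 1)\<close> show ?thesis
      by (simp add: c_def)
  qed
  then show ?thesis
    by blast
qed

text \<open>Riesz, applied to the functional sending \<open>u\<close> to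
  \<open>A u \<bullet> w\<close> for each \<open>w\<close>, shows that the choice defining
  \<open>adjoint\<close> has a witness.\<close>

lemma blinfun_inner_adjoint:
  fixes A :: "'a::{real_inner,complete_space} \<Rightarrow>\<^sub>L 'b::real_inner"
  shows "u \<bullet> adjoint (blinfun_apply A) v = blinfun_apply A u \<bullet> v"
proof -
  have "\<exists>g. \<forall>u. blinfun_apply A u \<bullet> w = u \<bullet> g" for w
    by (rule riesz_representation) (intro bounded_linear_intros)
  then have "\<exists>B. \<forall>u w. blinfun_apply A u \<bullet> w = u \<bullet> B w"
    by metis
  then show ?thesis
    unfolding adjoint_def by (rule someI2_ex) simp
qed

text \<open>The estimate in \<open>Y\<close> alone: \<open>a\<close> stands for
  \<open>F x' - F x\<close>, \<open>h\<close> for its linearisation \<open>F' x (x' - x)\<close>,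
  and \<open>r\<close> for the residual at \<open>x\<close>.\<close>

lemma inner_residual_le:
  fixes a r h :: "'b::real_inner"
  assumes cone: "norm (a - h) \<le> \<eta> * norm a"
    and noise: "norm (a + r) \<le> \<delta>"
    and "0 \<le> \<eta>"
  shows "norm r * ((1 - \<eta>) * norm r - (1 + \<eta>) * \<delta>) + h \<bullet> r \<le> 0"
proof -
  have "norm a \<le> \<delta> + norm r"
    using norm_triangle_ineq4[of "a + r" r] noise by simp
  then have "norm (a - h) \<le> \<eta> * (\<delta> + norm r)"
    by (rule order_trans[OF cone mult_left_mono[OF _ \<open>0 \<le> \<eta>\<close>]])
  then have "norm (a - h) * norm r \<le> \<eta> * (\<delta> + norm r) * norm r"
    by (rule mult_right_mono) simp
  then have "- ((a - h) \<bullet> r) \<le> \<eta> * (\<delta> + norm r) * norm r"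
    using Cauchy_Schwarz_ineq2[of "a - h" r] by linarith
  moreover have "(a + r) \<bullet> r \<le> \<delta> * norm r"
    using norm_cauchy_schwarz[of "a + r" r] mult_right_mono[OF noise norm_ge_zero[of r]]
    by linarith
  \<comment> \<open>Linearisation error, data noise and residual are separated; the last contributes
    the negative square.\<close>
  moreover have "h \<bullet> r = - ((a - h) \<bullet> r) + (a + r) \<bullet> r - (norm r)\<^sup>2"
    by (simp add: power2_norm_eq_inner inner_diff inner_add)
  ultimately have "h \<bullet> r \<le> \<eta> * (\<delta> + norm r) * norm r + \<delta> * norm r - (norm r)\<^sup>2"
    by linarith
  then show ?thesis
    by (simp add: power2_eq_square algebra_simps)
qed

theorem lemma4p1:
  fixes D :: "'a::{real_inner,complete_space} set"
    and F :: "'a \<Rightarrow> 'b::{real_inner,complete_space}"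
    and F' :: "'a \<Rightarrow> 'a \<Rightarrow>\<^sub>L 'b"
    and C \<rho> \<eta> \<delta> :: real
    and x\<^sub>0 x :: 'a
    and y y\<^sub>\<delta> :: 'b
  assumes A1: "assumption_A1 D F F' C \<rho> x\<^sub>0"
    and A2: "tangential_cone_condition F F' \<eta> \<rho> x\<^sub>0"
    and delta_pos: "\<delta> > 0"
    and noise: "norm (y\<^sub>\<delta> - y) \<le> \<delta>"
    and x_in: "x \<in> ball x\<^sub>0 \<rho>"
  shows "(\<forall>x'\<in>ball x\<^sub>0 \<rho> \<inter> preimage_in D F y.
            0 \<ge> norm (residual F y\<^sub>\<delta> x) *
                  ((1 - \<eta>) * norm (residual F y\<^sub>\<delta> x) - (1 + \<eta>) * \<delta>)
                + (x' - x) \<bullet> adjoint (blinfun_apply (F' x)) (residual F y\<^sub>\<delta> x))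
       \<and> ball x\<^sub>0 \<rho> \<inter> preimage_in D F y \<subseteq> half_space_H F F' \<eta> \<delta> y\<^sub>\<delta> x"
proof -
  have main: "norm (residual F y\<^sub>\<delta> x) *
        ((1 - \<eta>) * norm (residual F y\<^sub>\<delta> x) - (1 + \<eta>) * \<delta>)
      + (x' - x) \<bullet> adjoint (blinfun_apply (F' x)) (residual F y\<^sub>\<delta> x) \<le> 0"
    if x': "x' \<in> ball x\<^sub>0 \<rho> \<inter> preimage_in D F y" for x'
    unfolding blinfun_inner_adjoint
  proof (rule inner_residual_le)
    show "norm (F x' - F x - blinfun_apply (F' x) (x' - x)) \<le> \<eta> * norm (F x' - F x)"
      and "0 \<le> \<eta>"
      using A2 x_in x' by (auto simp: tangential_cone_condition_def)
    \<comment> \<open>As \<open>F x' = y\<close>, the sum telescopes to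
      \<open>y - y\<^sub>\<delta>\<close>.\<close>
    show "norm (F x' - F x + residual F y\<^sub>\<delta> x) \<le> \<delta>"
      using noise x' by (simp add: preimage_in_def residual_def norm_minus_commute)
  qed
  then show ?thesis
    by (fastforce simp: half_space_H_def)
qed

end
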